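(* In the setting of the context, for every $\epsilon>0$, if $n=n(N)$ is sufficiently large then $[O_N:O_{N,\epsilon}]\le n^{3n\epsilon/2}$.
   Context: $N$ runs over an infinite family of fields as follows: $p_1,\dots,p_\ell$ distinct primes $\equiv1\pmod4$, $L=\mathbb{Q}(\sqrt{p_1},\dots,\sqrt{p_\ell})$, $\mathcal{S}_0$ a non-empty finite subset of $O_L^*\cap(1+4O_L)$ with images in $O_L^*/(O_L^* )^2$ independent over $\mathbb{Z}/2$, each $w\in\mathcal{S}_0$ totally negative with $L(\sqrt w)/\mathbb{Q}$ Galois, $N=L(\sqrt w:w\in\mathcal{S}_0)$ of degree $n=2^{\#\mathcal{S}_0+\ell}$; the family has arbitrarily large degrees, $\#\mathcal{S}_0\ge c_0\ell^2$ for a fixed $c_0>0$, and for each $\epsilon>0$, $\Delta(N)^{1/n(N)}<n(N)^\epsilon$ and $n(L)<n(N)^\epsilon$ for all but finitely many $N$. For $T\subset\mathcal{S}_0$, $q_T=\prod_{w\in T}\sqrt w$ and $\eta_T=\prod_{w\in T}\frac{1+\sqrt w}{2}$. For $n$ sufficiently large (depending on $\epsilon$), $B_{T,\epsilon}$ is a $\mathbb{Z}$-basis of a finite index subgroup $M_{T,\epsilon}\subset O_Lq_T$ with $\|b\|_\infty\le n^\epsilon$, $\|b\|_2<n^{1/2+\epsilon}$ for $b\in B_{T,\epsilon}$ and $[O_Lq_T:M_{T,\epsilon}]\le n^{3\epsilon n(L)/2}$ (such bases exist for large $n$). $O_{N,\epsilon}$ is the subgroup of $O_N$ generated by $(bq_T^{-1})\eta_T$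 for all $T\subset\mathcal{S}_0$, $b\in B_{T,\epsilon}$. Norms: $\|x\|_\infty$ is the max of $|\sigma(x)|$ over embeddings $\sigma:N\to\mathbb{C}$; $\|x\|_2^2=\sum_{i=1}^{n/2}|\sigma_i(x)|^2$ over representatives of complex conjugate pairs. *)

theory Defs
  imports
    "HOL-Algebra.Algebraic_Closure_Type"
    "HOL-Algebra.Generated_Fields"
    "HOL-Computational_Algebra.Polynomial"
    "HOL-Computational_Algebra.Primes"
    "Jordan_Normal_Form.Determinant"
begin

text \<open>Number fields are represented by their carriers, as subfields of the complex numbers.\<close>

abbreviation CC :: "complex ring" where
  "CC \<equiv> ring_of_type_algebra"

global_interpretation Qvec: vector_space "\<lambda>(a::rat) (z::complex). of_rat a * z"
  by unfold_locales (simp_all add: algebra_simps of_rat_add of_rat_mult)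

global_interpretation Zmod: Modules.module "\<lambda>(a::int) (z::complex). of_int a * z"
  by unfold_locales (simp_all add: algebra_simps)

definition degree_over_Q :: "complex set \<Rightarrow> nat" where
  "degree_over_Q K = Qvec.dim K"

definition ring_of_integers :: "complex set \<Rightarrow> complex set" where
  "ring_of_integers K = {x \<in> K. algebraic_int x}"

definition integer_units :: "complex set \<Rightarrow> complex set" where
  "integer_units K = Units (CC\<lparr>carrier := ring_of_integers K\<rparr>)"

text \<open>Embeddings are taken to be \<^term>\<open>undefined\<close> off \<open>K\<close>, so that each
  homomorphism is counted once.\<close>

definition embeddings :: "complex set \<Rightarrow> (complex \<Rightarrow> complex) set" where
  "embeddings K = Ring.ring_hom (CC\<lparr>carrier := K\<rparr>) CC \<inter> extensional K"

text \<open>Applied only to fields that are finite over the rationals.\<close>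

definition galois_over_Q :: "complex set \<Rightarrow> bool" where
  "galois_over_Q K \<longleftrightarrow> {x \<in> K. \<forall>\<sigma>\<in>embeddings K. \<sigma> ` K = K \<longrightarrow> \<sigma> x = x} = \<rat>"

definition totally_negative :: "complex set \<Rightarrow> complex \<Rightarrow> bool" where
  "totally_negative K w \<longleftrightarrow> (\<forall>\<sigma>\<in>embeddings K. \<sigma> w \<in> \<real> \<and> Re (\<sigma> w) < 0)"

definition sup_norm :: "complex set \<Rightarrow> complex \<Rightarrow> real" where
  "sup_norm K x = Max ((\<lambda>\<sigma>. cmod (\<sigma> x)) ` embeddings K)"

definition conjugate_pairs :: "complex set \<Rightarrow> (complex \<Rightarrow> complex) set set" where
  "conjugate_pairs K = (\<lambda>\<sigma>. {\<sigma>, restrict (cnj \<circ> \<sigma>) K}) ` embeddings K"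

text \<open>Both members of a conjugate pair have the same absolute value at \<open>x\<close>, so the value does not
  depend on the representatives. For a totally complex field of degree \<open>n\<close> there are \<open>n/2\<close> pairs.\<close>

definition l2_norm :: "complex set \<Rightarrow> complex \<Rightarrow> real" where
  "l2_norm K x = sqrt (\<Sum>c\<in>conjugate_pairs K. (cmod ((SOME \<sigma>. \<sigma> \<in> c) x))\<^sup>2)"

definition is_Z_basis :: "complex set \<Rightarrow> complex set \<Rightarrow> bool" where
  "is_Z_basis B M \<longleftrightarrow> \<not> Zmod.dependent B \<and> Zmod.span B = M"

text \<open>The absolute value of the discriminant: it does not depend on the integral basis or on the
  enumeration of the embeddings.\<close>

definition abs_discriminant :: "complex set \<Rightarrow> real" where
  "abs_discriminant K = (THE d. \<exists>bs \<sigma>s.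
     distinct bs \<and> is_Z_basis (set bs) (ring_of_integers K) \<and>
     distinct \<sigma>s \<and> set \<sigma>s = embeddings K \<and>
     d = cmod ((det (mat (length \<sigma>s) (length bs) (\<lambda>(i, j). (\<sigma>s ! i) (bs ! j))))\<^sup>2))"

definition finite_index_subgroup :: "complex set \<Rightarrow> complex set \<Rightarrow> bool" where
  "finite_index_subgroup M A \<longleftrightarrow>
     additive_subgroup M (CC\<lparr>carrier := A\<rparr>) \<and> finite (a_rcosets\<^bsub>CC\<lparr>carrier := A\<rparr>\<^esub> M)"

definition subgroup_index :: "complex set \<Rightarrow> complex set \<Rightarrow> nat" where
  "subgroup_index A M = card (a_rcosets\<^bsub>CC\<lparr>carrier := A\<rparr>\<^esub> M)"

text \<open>In what follows \<open>P\<close> is the set of primes \<open>p\<^sub>1, \<dots>, p\<^sub>\<ell>\<close>, \<open>S\<close> is \<open>\<S>\<^sub>0\<close>, and \<open>r w\<close> is the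
  chosen square root of \<open>w \<in> S\<close>.\<close>

definition field_L :: "nat set \<Rightarrow> complex set" where
  "field_L P = generate_field CC ((\<lambda>p. complex_of_real (sqrt (real p))) ` P)"

text \<open>Independence over \<open>\<int>/2\<close> of the family of classes of the \<open>w \<in> S\<close> modulo squares of units, in
  multiplicative notation with coefficients represented by integers.\<close>

definition independent_mod_squares :: "complex set \<Rightarrow> complex set \<Rightarrow> bool" where
  "independent_mod_squares K S \<longleftrightarrow>
     (\<forall>e :: complex \<Rightarrow> int. (\<Prod>w\<in>S. w powi e w) \<in> (\<lambda>u. u\<^sup>2) ` integer_units K
        \<longrightarrow> (\<forall>w\<in>S. even (e w)))"

definition field_data ::
    "nat set \<Rightarrow> complex set \<Rightarrow> (complex \<Rightarrow> complex) \<Rightarrow> complex set \<Rightarrow> bool" where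
  "field_data P S r N \<longleftrightarrow>
     finite P \<and> (\<forall>p\<in>P. prime p \<and> p mod 4 = 1) \<and>
     finite S \<and> S \<noteq> {} \<and>
     S \<subseteq> integer_units (field_L P) \<inter> (\<lambda>a. 1 + 4 * a) ` ring_of_integers (field_L P) \<and>
     independent_mod_squares (field_L P) S \<and>
     (\<forall>w\<in>S. (r w)\<^sup>2 = w) \<and>
     (\<forall>w\<in>S. totally_negative (field_L P) w \<and>
            galois_over_Q (generate_field CC (insert (r w) (field_L P)))) \<and>
     N = generate_field CC (field_L P \<union> r ` S) \<and>
     degree_over_Q N = 2 ^ (card S + card P)"

definition field_family ::
    "real \<Rightarrow> complex set set \<Rightarrow> (complex set \<Rightarrow> nat set) \<Rightarrow> (complex set \<Rightarrow> complex set)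
       \<Rightarrow> (complex set \<Rightarrow> complex \<Rightarrow> complex) \<Rightarrow> bool" where
  "field_family c\<^sub>0 \<N> P S r \<longleftrightarrow>
     infinite \<N> \<and>
     (\<forall>N\<in>\<N>. field_data (P N) (S N) (r N) N) \<and>
     (\<forall>m. \<exists>N\<in>\<N>. degree_over_Q N \<ge> m) \<and>
     c\<^sub>0 > 0 \<and> (\<forall>N\<in>\<N>. real (card (S N)) \<ge> c\<^sub>0 * (real (card (P N)))\<^sup>2) \<and>
     (\<forall>\<epsilon>>0. finite {N \<in> \<N>. \<not>
        (abs_discriminant N powr (1 / real (degree_over_Q N)) < real (degree_over_Q N) powr \<epsilon> \<and>
         real (degree_over_Q (field_L (P N))) < real (degree_over_Q N) powr \<epsilon>)})"

definition q_elt :: "(complex \<Rightarrow> complex) \<Rightarrow> complex set \<Rightarrow> complex" where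
  "q_elt r T = (\<Prod>w\<in>T. r w)"

definition eta_elt :: "(complex \<Rightarrow> complex) \<Rightarrow> complex set \<Rightarrow> complex" where
  "eta_elt r T = (\<Prod>w\<in>T. (1 + r w) / 2)"

text \<open>\<open>B T\<close> is the basis \<open>B\<^sub>T\<^sub>,\<^sub>\<epsilon>\<close>, and \<^term>\<open>Zmod.span (B T)\<close> is the subgroup \<open>M\<^sub>T\<^sub>,\<^sub>\<epsilon>\<close>.\<close>

definition admissible_bases ::
    "nat set \<Rightarrow> complex set \<Rightarrow> (complex \<Rightarrow> complex) \<Rightarrow> complex set \<Rightarrow> real
       \<Rightarrow> (complex set \<Rightarrow> complex set) \<Rightarrow> bool" where
  "admissible_bases P S r N \<epsilon> B \<longleftrightarrow> (\<forall>T\<subseteq>S.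
     let n = real (degree_over_Q N);
         A = (\<lambda>x. x * q_elt r T) ` ring_of_integers (field_L P);
         M = Zmod.span (B T)
     in is_Z_basis (B T) M \<and> finite_index_subgroup M A \<and>
        (\<forall>b\<in>B T. sup_norm N b \<le> n powr \<epsilon> \<and> l2_norm N b < n powr (1/2 + \<epsilon>)) \<and>
        real (subgroup_index A M) \<le> n powr (3 * \<epsilon> * real (degree_over_Q (field_L P)) / 2))"

definition O_eps ::
    "complex set \<Rightarrow> (complex \<Rightarrow> complex) \<Rightarrow> (complex set \<Rightarrow> complex set) \<Rightarrow> complex set" where
  "O_eps S r B = Zmod.span {(b * inverse (q_elt r T)) * eta_elt r T | T b. T \<subseteq> S \<and> b \<in> B T}"

end

theory Submission
  imports Defs "Jordan_Normal_Form.Char_Poly"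
begin

text \<open>If \<open>w = s\<^sup>2\<close> is a unit congruent to \<open>1\<close> modulo \<open>4\<close>, adjoining \<open>s\<close> to \<open>K\<close> enlarges \<open>O\<^sub>K\<close> to
  \<open>O\<^sub>K + O\<^sub>K (1 + s)/2\<close>. Adjoining one root at a time, \<open>O\<^sub>N\<close> is the sum of the \<open>O\<^sub>L \<eta>\<^sub>T\<close>, so \<open>O\<^sub>N\<close> modulo
  \<open>O\<^sub>N\<^sub>,\<^sub>\<epsilon>\<close> is a quotient of the direct sum of the groups \<open>O\<^sub>L q\<^sub>T\<close> modulo \<open>M\<^sub>T\<^sub>,\<^sub>\<epsilon>\<close>. There are \<open>2\<^bsup>#S\<^esup>\<close>
  sets \<open>T\<close>, and \<open>2\<^bsup>#S\<^esup> n(L) \<le> n(N)\<close> since \<open>L\<close> is spanned by \<open>2\<^bsup>\<ell>\<^esup>\<close> products of square roots.\<close>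

section \<open>Algebraic integers form a ring\<close>

text \<open>Multiplication by \<open>z\<close> on the list of elements of \<open>V\<close> is given
  by an integer matrix, for which that list is an eigenvector with eigenvalue \<open>z\<close>; it
  is nonzero because of \<open>v0\<close>. So \<open>z\<close> is a root of a characteristic
  polynomial, which is monic with integer coefficients.\<close>

lemma algebraic_int_if_stabilizes_span:
  fixes z :: complex
  assumes fin: "finite V" and v0: "v0 \<in> V" "v0 \<noteq> 0"
    and stable: "\<And>v. v \<in> V \<Longrightarrow> z * v \<in> Zmod.span V"
  shows "algebraic_int z"
proof -
  obtain f where f: "bij_betw f {0..<card V} V"
    using ex_bij_betw_nat_finite[OF fin] by blast
  define n where "n = card V"
  have "\<exists>u :: complex \<Rightarrow> int. z * v = (\<Sum>x\<in>V. of_int (u x) * x)" if "v \<in> V" for v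
    using stable[OF that] by (auto simp: Zmod.span_finite[OF fin])
  then obtain u :: "complex \<Rightarrow> complex \<Rightarrow> int"
    where u: "\<And>v. v \<in> V \<Longrightarrow> z * v = (\<Sum>x\<in>V. of_int (u v x) * x)"
    by metis
  define A where "A = mat n n (\<lambda>(i, j). u (f i) (f j))"
  define A' where "A' = (map_mat of_int A :: complex mat)"
  define v where "v = vec n f"
  have A: "A \<in> carrier_mat n n" and A': "A' \<in> carrier_mat n n" and v: "v \<in> carrier_vec n"
    by (simp_all add: A_def A'_def v_def)
  obtain i0 where i0: "i0 < n" "f i0 = v0"
    using v0(1) f unfolding n_def bij_betw_def by (metis imageE atLeastLessThan_iff)
  have "v \<noteq> 0\<^sub>v n"
  proof
    assume "v = 0\<^sub>v n"
    then have "v $ i0 = 0" using i0 by simp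
    then show False using i0 v0 by (simp add: v_def)
  qed
  moreover have "A' *\<^sub>v v = z \<cdot>\<^sub>v v"
  proof (rule eq_vecI)
    fix i assume "i < dim_vec (z \<cdot>\<^sub>v v)"
    then have i: "i < n" by (simp add: v_def)
    then have "f i \<in> V" using f unfolding n_def bij_betw_def by auto
    then have "z * f i = (\<Sum>x\<in>V. of_int (u (f i) x) * x)" by (rule u)
    also have "\<dots> = (\<Sum>j = 0..<n. of_int (u (f i) (f j)) * f j)"
      using sum.reindex_bij_betw[OF f, of "\<lambda>x. of_int (u (f i) x) * x"] by (simp add: n_def)
    finally show "(A' *\<^sub>v v) $ i = (z \<cdot>\<^sub>v v) $ i"
      using i by (simp add: A'_def A_def v_def scalar_prod_def)
  qed (simp add: A'_def A_def v_def)
  ultimately have "eigenvalue A' z"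
    using A' v unfolding eigenvalue_def eigenvector_def by auto
  then have "poly (char_poly A') z = 0"
    using eigenvalue_root_char_poly[OF A'] by simp
  moreover have "char_poly A' = map_poly of_int (char_poly A)"
    unfolding A'_def by (rule of_int_hom.char_poly_hom[OF A])
  moreover have "lead_coeff (char_poly A) = 1"
    using degree_monic_char_poly[OF A] by simp
  ultimately show ?thesis
    unfolding algebraic_int_altdef_ipoly by (intro exI[of _ "char_poly A"]) simp
qed

lemma algebraic_intE_power:
  fixes x :: complex
  assumes "algebraic_int x"
  obtains m and c :: "nat \<Rightarrow> int" where "m > 0" "x ^ m = (\<Sum>i<m. of_int (c i) * x ^ i)"
proof -
  obtain p :: "int poly" where p: "poly (map_poly of_int p) x = 0" "lead_coeff p = 1"
    using assms unfolding algebraic_int_altdef_ipoly by blast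
  define m where "m = degree p"
  have "(\<Sum>i\<le>m. of_int (coeff p i) * x ^ i) = 0"
    using p(1) by (simp add: poly_altdef m_def)
  then have "(\<Sum>i<m. of_int (coeff p i) * x ^ i) + x ^ m = 0"
    using p(2) by (simp add: m_def flip: lessThan_Suc_atMost)
  then have "x ^ m = - (\<Sum>i<m. of_int (coeff p i) * x ^ i)"
    by (simp only: add_eq_0_iff)
  then have eq: "x ^ m = (\<Sum>i<m. of_int (- coeff p i) * x ^ i)"
    by (simp add: sum_negf)
  \<comment> \<open>For \<open>m = 0\<close> the sum is empty and the relation would read 1 =
    0.\<close>
  have "m > 0"
  proof (rule ccontr)
    assume "\<not> m > 0"
    with eq show False by simp
  qed
  then show ?thesis using eq by (rule that)
qed

text \<open>Multiplying a generator by \<open>x\<close> raises one exponent by 1. It leaves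
  \<open>V\<close> only when the exponent reaches \<open>m\<close>, and then the monic relation
  rewrites \<open>x ^ m\<close> in lower powers.\<close>

lemma mult_mem_span_power_products:
  fixes x y :: complex and m k :: nat
  defines "V \<equiv> {x ^ i * y ^ j | i j. i < m \<and> j < k}"
  assumes pow: "x ^ m = (\<Sum>i<m. of_int (c i) * x ^ i)" and v: "v \<in> Zmod.span V"
  shows "x * v \<in> Zmod.span V"
  using v
proof (induction rule: Zmod.span_induct_alt)
  case base
  show ?case by (simp add: Zmod.span_zero)
next
  case (step a v w)
  then obtain i j where ij: "i < m" "j < k" "v = x ^ i * y ^ j" by (auto simp: V_def)
  have V: "x ^ i * y ^ j \<in> Zmod.span V" if "i < m" for i
    using that ij(2) by (auto simp: V_def intro!: Zmod.span_base)
  have "x * v \<in> Zmod.span V"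
  proof (cases "Suc i < m")
    case True
    then show ?thesis using V[of "Suc i"] ij by (simp add: mult.assoc)
  next
    case False
    then have "m = Suc i" using ij by simp
    then have "x * v = x ^ m * y ^ j" using ij by simp
    also have "\<dots> = (\<Sum>i<m. of_int (c i) * (x ^ i * y ^ j))"
      by (subst pow) (simp add: sum_distrib_right mult.assoc)
    also have "\<dots> \<in> Zmod.span V"
      by (intro Zmod.span_sum Zmod.span_scale V) auto
    finally show ?thesis .
  qed
  then have "of_int a * (x * v) + x * w \<in> Zmod.span V"
    using step by (intro Zmod.span_add Zmod.span_scale)
  then show ?case by (simp add: algebra_simps)
qed

text \<open>A span stable under both \<open>x\<close> and \<open>y\<close> is stable under their sum
  and product, which makes these integral; 1 serves as the nonzero element of
  \<open>V\<close>.\<close>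

lemma algebraic_int_pair_stable:
  fixes x y :: complex
  assumes "algebraic_int x" "algebraic_int y"
  obtains V where "finite V" "1 \<in> V" "\<And>v. v \<in> Zmod.span V \<Longrightarrow> x * v \<in> Zmod.span V"
    "\<And>v. v \<in> Zmod.span V \<Longrightarrow> y * v \<in> Zmod.span V"
proof -
  obtain m c where m: "m > 0" "x ^ m = (\<Sum>i<m. of_int (c i) * x ^ i)"
    using algebraic_intE_power[OF assms(1)] .
  obtain k d where k: "k > 0" "y ^ k = (\<Sum>i<k. of_int (d i) * y ^ i)"
    using algebraic_intE_power[OF assms(2)] .
  define V where "V = {x ^ i * y ^ j | i j. i < m \<and> j < k}"
  \<comment> \<open>In this form the roles of \<open>x\<close> and \<open>y\<close> are exchanged,
    so the previous lemma also covers multiplication by \<open>y\<close>.\<close>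
  have swap: "V = {y ^ j * x ^ i | j i. j < k \<and> i < m}"
    unfolding V_def by (force simp: mult.commute)
  have "V = (\<lambda>(i, j). x ^ i * y ^ j) ` ({..<m} \<times> {..<k})"
    by (auto simp: V_def)
  then have "finite V" by simp
  moreover have "1 \<in> V"
    unfolding V_def using m(1) k(1) by (intro CollectI exI[of _ 0]) simp
  moreover have "x * v \<in> Zmod.span V" if "v \<in> Zmod.span V" for v
    using mult_mem_span_power_products[OF m(2)] that unfolding V_def .
  moreover have "y * v \<in> Zmod.span V" if "v \<in> Zmod.span V" for v
    using mult_mem_span_power_products[OF k(2)] that unfolding swap .
  ultimately show ?thesis by (intro that)
qed

lemma algebraic_int_add:
  fixes x y :: complex
  assumes "algebraic_int x" "algebraic_int y"
  shows "algebraic_int (x + y)"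
proof -
  obtain V where V: "finite V" "1 \<in> V" "\<And>v. v \<in> Zmod.span V \<Longrightarrow> x * v \<in> Zmod.span V"
    "\<And>v. v \<in> Zmod.span V \<Longrightarrow> y * v \<in> Zmod.span V"
    using algebraic_int_pair_stable[OF assms] by blast
  show ?thesis
  proof (rule algebraic_int_if_stabilizes_span[OF V(1,2)])
    show "(x + y) * v \<in> Zmod.span V" if "v \<in> V" for v
      using V(3,4)[of v] that by (simp add: Zmod.span_base Zmod.span_add distrib_right)
  qed simp
qed

lemma algebraic_int_mult:
  fixes x y :: complex
  assumes "algebraic_int x" "algebraic_int y"
  shows "algebraic_int (x * y)"
proof -
  obtain V where V: "finite V" "1 \<in> V" "\<And>v. v \<in> Zmod.span V \<Longrightarrow> x * v \<in> Zmod.span V"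
    "\<And>v. v \<in> Zmod.span V \<Longrightarrow> y * v \<in> Zmod.span V"
    using algebraic_int_pair_stable[OF assms] by blast
  show ?thesis
  proof (rule algebraic_int_if_stabilizes_span[OF V(1,2)])
    show "x * y * v \<in> Zmod.span V" if "v \<in> V" for v
      using V(3)[OF V(4)[of v]] that by (simp add: Zmod.span_base mult.assoc)
  qed simp
qed

lemma algebraic_int_diff:
  fixes x y :: complex
  assumes "algebraic_int x" "algebraic_int y"
  shows "algebraic_int (x - y)"
  using algebraic_int_add[of x "- y"] assms by simp

lemma algebraic_int_of_power2:
  fixes x :: complex
  assumes "algebraic_int (x\<^sup>2)"
  shows "algebraic_int x"
proof (rule algebraic_int_root[OF assms])
  show "poly (monom 1 2) x = x\<^sup>2" by (simp add: poly_monom)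
qed (auto simp: degree_monom_eq)

section \<open>Quadratic extensions inside the complex numbers\<close>

lemma CC_simps [simp]:
  "carrier CC = UNIV" "monoid.mult CC = (*)" "one CC = 1" "ring.zero CC = 0" "ring.add CC = (+)"
  by (simp_all add: ring_of_type_algebra_def)

lemma field_CC: "field CC" and cring_CC: "cring CC" and ring_CC: "ring CC"
  by (rule field_from_type_algebra cring_from_type_algebra ring_from_type_algebra)+

lemma CC_a_inv [simp]: "\<ominus>\<^bsub>CC\<^esub> x = - x"
  by (rule abelian_group.minus_equality[OF ring.is_abelian_group[OF ring_CC]]) simp_all

lemma CC_m_inv [simp]: "x \<noteq> 0 \<Longrightarrow> inv\<^bsub>CC\<^esub> x = inverse x"
  by (rule comm_monoid.comm_inv_char[OF cring.axioms(2)[OF cring_CC]]) simp_all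

text \<open>From here on subfields of \<open>CC\<close> are handled by closure under ordinary
  complex arithmetic instead of the operations of the ring record.\<close>

lemma subfield_CC_iff:
  "subfield K CC \<longleftrightarrow> 1 \<in> K \<and> (\<forall>x\<in>K. - x \<in> K) \<and> (\<forall>x\<in>K. \<forall>y\<in>K. x + y \<in> K)
     \<and> (\<forall>x\<in>K. \<forall>y\<in>K. x * y \<in> K) \<and> (\<forall>x\<in>K. x \<noteq> 0 \<longrightarrow> inverse x \<in> K)"
proof
  interpret CC: field CC by (rule field_CC)
  assume K: "subfield K CC"
  note R = subringE[OF subfieldE(1)[OF K]]
  have "inverse x \<in> K" if "x \<in> K" "x \<noteq> 0" for x
    using CC.subfield_m_inv(1)[OF K, of x] that by simp
  with R(3,5,6,7) show "1 \<in> K \<and> (\<forall>x\<in>K. - x \<in> K) \<and> (\<forall>x\<in>K. \<forall>y\<in>K. x + y \<in> K)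
     \<and> (\<forall>x\<in>K. \<forall>y\<in>K. x * y \<in> K) \<and> (\<forall>x\<in>K. x \<noteq> 0 \<longrightarrow> inverse x \<in> K)"
    by simp
next
  assume *: "1 \<in> K \<and> (\<forall>x\<in>K. - x \<in> K) \<and> (\<forall>x\<in>K. \<forall>y\<in>K. x + y \<in> K)
     \<and> (\<forall>x\<in>K. \<forall>y\<in>K. x * y \<in> K) \<and> (\<forall>x\<in>K. x \<noteq> 0 \<longrightarrow> inverse x \<in> K)"
  have "subring K CC"
    by (rule ring.subringI[OF ring_CC]) (use * in simp_all)
  then show "subfield K CC"
    by (rule field.subfieldI'[OF field_CC]) (use * in simp)
qed

lemma subfield_generate_field_CC: "subfield (generate_field CC H) CC"
  by (rule field.generate_field_is_subfield[OF field_CC]) simp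

lemma generate_field_CC_minimal:
  assumes "subfield E CC" "H \<subseteq> E"
  shows "generate_field CC H \<subseteq> E"
  using assms by (intro field.generate_field_min_subfield1[OF field_CC]) simp_all

lemma subfield_CC_closed:
  assumes "subfield K CC"
  shows "1 \<in> K" "0 \<in> K" "\<And>x. x \<in> K \<Longrightarrow> - x \<in> K" "\<And>x y. x \<in> K \<Longrightarrow> y \<in> K \<Longrightarrow> x + y \<in> K"
    "\<And>x y. x \<in> K \<Longrightarrow> y \<in> K \<Longrightarrow> x - y \<in> K" "\<And>x y. x \<in> K \<Longrightarrow> y \<in> K \<Longrightarrow> x * y \<in> K"
    "\<And>x. x \<in> K \<Longrightarrow> inverse x \<in> K" "\<And>x y. x \<in> K \<Longrightarrow> y \<in> K \<Longrightarrow> x / y \<in> K"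
    "\<And>a. of_int a \<in> K" "\<And>a. numeral a \<in> K"
proof -
  note K = assms[unfolded subfield_CC_iff]
  show one: "1 \<in> K" and minus: "\<And>x. x \<in> K \<Longrightarrow> - x \<in> K"
    and add: "\<And>x y. x \<in> K \<Longrightarrow> y \<in> K \<Longrightarrow> x + y \<in> K"
    and mult: "\<And>x y. x \<in> K \<Longrightarrow> y \<in> K \<Longrightarrow> x * y \<in> K"
    using K by blast+
  show zero: "0 \<in> K" using add[OF one minus[OF one]] by simp
  show diff: "\<And>x y. x \<in> K \<Longrightarrow> y \<in> K \<Longrightarrow> x - y \<in> K"
    using add[OF _ minus] by simp
  show inv: "inverse x \<in> K" if "x \<in> K" for x
    using K that zero by (cases "x = 0") auto
  show "\<And>x y. x \<in> K \<Longrightarrow> y \<in> K \<Longrightarrow> x / y \<in> K"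
    using mult[OF _ inv] by (simp add: divide_inverse)
  have nat: "of_nat k \<in> K" for k :: nat
    by (induction k) (simp_all add: zero add one)
  show "of_int a \<in> K" for a
    by (cases a rule: int_cases2) (simp_all add: nat minus)
  show "numeral a \<in> K" for a
    using nat[of "numeral a"] by simp
qed

text \<open>The set K + K s is already a field: the inverse of u + v s is its conjugate u - v s
  divided by the norm. The case of \<open>s\<close> in \<open>K\<close> is separate because there
  the norm of a nonzero element can vanish.\<close>

lemma generate_field_insert_sqrt:
  assumes K: "subfield K CC" and s: "s\<^sup>2 \<in> K"
  shows "generate_field CC (insert s K) \<subseteq> {u + v * s | u v. u \<in> K \<and> v \<in> K}"
proof (cases "s \<in> K")
  case True
  then have "generate_field CC (insert s K) \<subseteq> K"
    by (intro generate_field_CC_minimal K) simp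
  moreover have "x = x + 0 * s" for x by simp
  ultimately show ?thesis using subfield_CC_closed(2)[OF K] by blast
next
  case False
  note cl = subfield_CC_closed[OF K]
  let ?E = "{u + v * s | u v. u \<in> K \<and> v \<in> K}"
  have I: "x \<in> ?E" if "x = u + v * s" "u \<in> K" "v \<in> K" for x u v
    using that by blast
  \<comment> \<open>If the norm vanished, the second factor would have to be zero, so that s = u / v
    would lie in \<open>K\<close>.\<close>
  have nz: "u\<^sup>2 - v\<^sup>2 * s\<^sup>2 \<noteq> 0" if "u \<in> K" "v \<in> K" "u + v * s \<noteq> 0" for u v
  proof
    assume "u\<^sup>2 - v\<^sup>2 * s\<^sup>2 = 0"
    then have "(u + v * s) * (u - v * s) = 0" by (simp add: algebra_simps power2_eq_square)
    then have u: "u = v * s" using that(3) by simp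
    with that(3) have "v \<noteq> 0" by auto
    with u have "s = u / v" by simp
    with cl(8)[OF that(1,2)] False show False by simp
  qed
  have "subfield ?E CC"
    unfolding subfield_CC_iff
  proof (intro conjI ballI impI)
    show "1 \<in> ?E" by (rule I[of _ 1 0]) (simp_all add: cl)
  next
    fix x assume "x \<in> ?E"
    then obtain u v where *: "x = u + v * s" "u \<in> K" "v \<in> K" by blast
    show "- x \<in> ?E" by (rule I[of _ "- u" "- v"]) (simp_all add: * cl)
  next
    fix x y assume "x \<in> ?E" "y \<in> ?E"
    then obtain u v u' v' where *: "x = u + v * s" "u \<in> K" "v \<in> K" "y = u' + v' * s" "u' \<in> K" "v' \<in> K"
      by blast
    show "x + y \<in> ?E" by (rule I[of _ "u + u'" "v + v'"]) (simp_all add: * cl algebra_simps)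
    show "x * y \<in> ?E"
    proof (rule I)
      show "x * y = (u * u' + v * v' * s\<^sup>2) + (u * v' + v * u') * s"
        by (simp add: * algebra_simps power2_eq_square)
    qed (intro cl * s)+
  next
    fix x assume "x \<in> ?E" "x \<noteq> 0"
    then obtain u v where *: "x = u + v * s" "u \<in> K" "v \<in> K" by blast
    define d where "d = u\<^sup>2 - v\<^sup>2 * s\<^sup>2"
    have d: "d \<noteq> 0" using nz[OF *(2,3)] * \<open>x \<noteq> 0\<close> by (simp add: d_def)
    have dK: "d \<in> K" unfolding d_def power2_eq_square[of u] power2_eq_square[of v] by (intro cl * s)
    have "(u + v * s) * (u - v * s) = d"
      by (simp add: d_def algebra_simps power2_eq_square)
    then have "inverse x = (u - v * s) / d"
      using d \<open>x \<noteq> 0\<close> * by (simp add: field_simps)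
    then have e: "inverse x = u / d + (- v / d) * s" by (simp add: diff_divide_distrib)
    show "inverse x \<in> ?E"
      by (rule I[OF e]) (intro cl * dK)+
  qed
  moreover have "insert s K \<subseteq> ?E"
    using I[of s 0 1] I[of _ _ 0] by (auto simp: cl)
  ultimately show ?thesis by (rule generate_field_CC_minimal)
qed

text \<open>This splits a multiquadratic extension into a tower with one new root per stage, the
  shape that the later inductions use.\<close>

lemma generate_field_Un_image_insert:
  "generate_field CC (K \<union> f ` insert w T) \<subseteq>
    generate_field CC (insert (f w) (generate_field CC (K \<union> f ` T)))"
proof (rule generate_field_CC_minimal[OF subfield_generate_field_CC])
  show "K \<union> f ` insert w T \<subseteq> generate_field CC (insert (f w) (generate_field CC (K \<union> f ` T)))"
    by (auto intro: generate_field.incl)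
qed

section \<open>Integers of a quadratic extension\<close>

lemma ring_of_integers_closed:
  assumes "subfield K CC"
  shows "0 \<in> ring_of_integers K"
    "\<And>x y. x \<in> ring_of_integers K \<Longrightarrow> y \<in> ring_of_integers K \<Longrightarrow> x + y \<in> ring_of_integers K"
    "\<And>x y. x \<in> ring_of_integers K \<Longrightarrow> y \<in> ring_of_integers K \<Longrightarrow> x * y \<in> ring_of_integers K"
    "\<And>a. of_int a \<in> ring_of_integers K"
  using subfield_CC_closed[OF assms]
  by (auto simp: ring_of_integers_def algebraic_int_add algebraic_int_mult)

text \<open>This stands in for the automorphism sending s to -s. Induction along Horner's scheme
  computes both values at once, and the same \<open>a\<close> and \<open>b\<close> serve for both
  signs.\<close>

lemma poly_quadratic_conjugate:
  fixes p :: "complex poly"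
  assumes K: "subfield K CC" and s: "s\<^sup>2 \<in> K" and uv: "u \<in> K" "v \<in> K"
    and coeffs: "\<And>i. coeff p i \<in> K"
  shows "\<exists>a\<in>K. \<exists>b\<in>K. poly p (u + v * s) = a + b * s \<and> poly p (u - v * s) = a - b * s"
  using coeffs
proof (induction p)
  case 0
  show ?case by (auto intro!: bexI[of _ 0] simp: subfield_CC_closed[OF K])
next
  case (pCons c p)
  note cl = subfield_CC_closed[OF K]
  have "coeff p i \<in> K" for i using pCons.prems[of "Suc i"] by simp
  then obtain a b where ab: "a \<in> K" "b \<in> K" "poly p (u + v * s) = a + b * s"
    "poly p (u - v * s) = a - b * s"
    using pCons.IH by blast
  have c: "c \<in> K" using pCons.prems[of 0] by simp
  show ?case
  proof (intro bexI conjI)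
    show "poly (pCons c p) (u + v * s) = (c + u * a + v * b * s\<^sup>2) + (u * b + v * a) * s"
      unfolding poly_pCons ab(3) by (simp add: algebra_simps power2_eq_square)
    show "poly (pCons c p) (u - v * s) = (c + u * a + v * b * s\<^sup>2) - (u * b + v * a) * s"
      unfolding poly_pCons ab(4) by (simp add: algebra_simps power2_eq_square)
  qed (intro cl ab c uv s)+
qed

lemma algebraic_int_quadratic_conjugate:
  assumes K: "subfield K CC" and s: "s\<^sup>2 \<in> K" "s \<notin> K" and uv: "u \<in> K" "v \<in> K"
    and "algebraic_int (u + v * s)"
  shows "algebraic_int (u - v * s)"
proof -
  note cl = subfield_CC_closed[OF K]
  obtain p where p: "lead_coeff p = 1" "\<forall>i. coeff p i \<in> \<int>" "poly p (u + v * s) = 0"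
    using assms(6) by (auto simp: algebraic_int.simps)
  have "coeff p i \<in> K" for i
    by (rule Ints_cases[OF p(2)[rule_format, of i]]) (simp add: cl)
  from poly_quadratic_conjugate[OF K s(1) uv this]
  obtain a b where ab: "a \<in> K" "b \<in> K" "poly p (u + v * s) = a + b * s"
    "poly p (u - v * s) = a - b * s" by blast
  \<comment> \<open>The value a + b s is 0 and \<open>s\<close> is outside \<open>K\<close>, so
    \<open>b\<close> and then \<open>a\<close> vanish; the conjugate is thus a root of the same
    monic polynomial.\<close>
  have "b = 0"
  proof (rule ccontr)
    assume "b \<noteq> 0"
    then have "s = - a / b" using ab(3) p(3) by (simp add: field_simps add_eq_0_iff)
    then show False using cl(8)[OF cl(3)[OF ab(1)] ab(2)] s(2) by simp
  qed
  then have "poly p (u - v * s) = 0" using ab p(3) by simp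
  then show ?thesis using p by (intro algebraic_int.intros)
qed

text \<open>The number t = (1 + s)/2 satisfies t^2 - t = a, so a monic integer polynomial takes an
  integral value at it.\<close>

lemma algebraic_int_half_one_plus_sqrt:
  assumes "algebraic_int a" "s\<^sup>2 = 1 + 4 * a"
  shows "algebraic_int ((1 + s) / 2 :: complex)"
proof -
  have "((1 + s) / 2)\<^sup>2 - (1 + s) / 2 = a"
    using assms(2) by (simp add: power2_eq_square field_simps)
  then have "poly [:0, -1, 1:] ((1 + s) / 2) = a"
    by (simp add: power2_eq_square algebra_simps)
  moreover have "\<forall>i. coeff [:0, -1, 1 :: complex:] i \<in> \<int>"
    by (simp add: coeff_pCons split: nat.split)
  ultimately show ?thesis
    by (rule algebraic_int_root[OF assms(1)]) simp_all
qed

text \<open>As \<open>s\<close> is a unit, integrality of the conjugates \<open>u \<plusminus> v s\<close> makes \<open>2v\<close> integral, and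
  \<open>u + v s = (u - v) + 2v (1 + s)/2\<close>.\<close>

lemma ring_of_integers_quadratic:
  assumes K: "subfield K CC" and a: "a \<in> ring_of_integers K" and s: "s\<^sup>2 = 1 + 4 * a"
    and unit: "algebraic_int (inverse s)"
    and x: "x \<in> ring_of_integers (generate_field CC (insert s K))"
  shows "\<exists>y\<in>ring_of_integers K. \<exists>z\<in>ring_of_integers K. x = y + z * ((1 + s) / 2)"
proof -
  note cl = subfield_CC_closed[OF K]
  have sK: "s\<^sup>2 \<in> K" using a s by (simp add: ring_of_integers_def cl)
  show ?thesis
  proof (cases "s \<in> K")
    \<comment> \<open>Here adjoining \<open>s\<close> does not enlarge \<open>K\<close>, so
      \<open>x\<close> itself and the coefficient 0 do.\<close>
    case True
    then have "generate_field CC (insert s K) \<subseteq> K"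
      by (intro generate_field_CC_minimal K) simp
    then have "x \<in> ring_of_integers K" using x by (auto simp: ring_of_integers_def)
    then show ?thesis
      using ring_of_integers_closed(1)[OF K] by (intro bexI[of _ x] bexI[of _ 0]) auto
  next
    case False
    then have s0: "s \<noteq> 0" using cl(2) by auto
    obtain u v where uv: "x = u + v * s" "u \<in> K" "v \<in> K"
      using generate_field_insert_sqrt[OF K sK] x by (auto simp: ring_of_integers_def)
    have xi: "algebraic_int (u + v * s)" using x uv by (simp add: ring_of_integers_def)
    from algebraic_int_quadratic_conjugate[OF K sK False uv(2,3) this]
    have xi': "algebraic_int (u - v * s)" .
    have "algebraic_int (((u + v * s) - (u - v * s)) * inverse s)"
      by (intro algebraic_int_mult algebraic_int_diff xi xi' unit)
    then have z: "algebraic_int (2 * v)" using s0 by (simp add: field_simps)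
    have "algebraic_int (u + v * s - 2 * v * ((1 + s) / 2))"
      using a s
      by (intro algebraic_int_mult algebraic_int_diff xi z algebraic_int_half_one_plus_sqrt)
        (auto simp: ring_of_integers_def)
    then have "algebraic_int (u - v)" by (simp add: field_simps)
    with z uv show ?thesis
      by (intro bexI[of _ "u - v"] bexI[of _ "2 * v"])
        (simp_all add: ring_of_integers_def cl field_simps)
  qed
qed

text \<open>The coefficient set and the factors are left general to serve two towers: fields, with
  \<open>f\<close> the square roots, and rings of integers, with factors (1 + root)/2.\<close>

definition subset_expansions :: "complex set \<Rightarrow> ('a \<Rightarrow> complex) \<Rightarrow> 'a set \<Rightarrow> complex set" where
  "subset_expansions R f T = {\<Sum>U\<in>Pow T. c U * (\<Prod>w\<in>U. f w) | c. \<forall>U. U \<subseteq> T \<longrightarrow> c U \<in> R}"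

lemma subset_expansionsI:
  assumes "x = (\<Sum>U\<in>Pow T. c U * (\<Prod>w\<in>U. f w))" "\<And>U. U \<subseteq> T \<Longrightarrow> c U \<in> R"
  shows "x \<in> subset_expansions R f T"
  using assms unfolding subset_expansions_def by (intro CollectI exI[of _ c]) simp

lemma subset_expansionsE:
  assumes "x \<in> subset_expansions R f T"
  obtains c where "x = (\<Sum>U\<in>Pow T. c U * (\<Prod>w\<in>U. f w))" "\<And>U. U \<subseteq> T \<Longrightarrow> c U \<in> R"
  using assms unfolding subset_expansions_def by (elim CollectE exE conjE) (rule that; blast)

lemma subset_expansions_empty:
  assumes "x \<in> R"
  shows "x \<in> subset_expansions R f {}"
  by (rule subset_expansionsI[of _ "\<lambda>_. x"]) (simp_all add: assms)

text \<open>Subsets of \<open>insert w T\<close> are sorted by whether they contain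
  \<open>w\<close>: \<open>y\<close> supplies the coefficients of those without \<open>w\<close>,
  and \<open>z\<close> of those with it.\<close>

lemma subset_expansions_insert:
  assumes "finite T" "w \<notin> T" "y \<in> subset_expansions R f T" "z \<in> subset_expansions R f T"
  shows "y + z * f w \<in> subset_expansions R f (insert w T)"
proof -
  obtain c where c: "y = (\<Sum>U\<in>Pow T. c U * (\<Prod>w\<in>U. f w))" "\<And>U. U \<subseteq> T \<Longrightarrow> c U \<in> R"
    by (rule subset_expansionsE[OF assms(3)]) (erule that, blast)
  obtain d where d: "z = (\<Sum>U\<in>Pow T. d U * (\<Prod>w\<in>U. f w))" "\<And>U. U \<subseteq> T \<Longrightarrow> d U \<in> R"
    by (rule subset_expansionsE[OF assms(4)]) (erule that, blast)
  define e where "e U = (if w \<in> U then d (U - {w}) else c U)" for U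
  have "(\<Sum>U\<in>Pow (insert w T). e U * (\<Prod>w\<in>U. f w))
      = (\<Sum>U\<in>Pow T. e U * (\<Prod>w\<in>U. f w)) + (\<Sum>U\<in>insert w ` Pow T. e U * (\<Prod>w\<in>U. f w))"
    unfolding Pow_insert using assms(1,2) by (intro sum.union_disjoint) auto
  also have "(\<Sum>U\<in>Pow T. e U * (\<Prod>w\<in>U. f w)) = y"
    unfolding c(1) using assms(2) by (intro sum.cong) (auto simp: e_def)
  also have "inj_on (insert w) (Pow T)"
    using assms(2) by (auto intro!: inj_onI)
  then have "(\<Sum>U\<in>insert w ` Pow T. e U * (\<Prod>w\<in>U. f w))
      = (\<Sum>U\<in>Pow T. e (insert w U) * (\<Prod>w\<in>insert w U. f w))"
    by (simp add: sum.reindex)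
  also have "\<dots> = z * f w"
    unfolding d(1) sum_distrib_right
  proof (rule sum.cong)
    fix U assume "U \<in> Pow T"
    then have "finite U" "w \<notin> U" using assms(1,2) finite_subset by auto
    then show "e (insert w U) * (\<Prod>w\<in>insert w U. f w) = d U * (\<Prod>w\<in>U. f w) * f w"
      by (simp add: e_def ac_simps)
  qed simp
  finally have "y + z * f w = (\<Sum>U\<in>Pow (insert w T). e U * (\<Prod>w\<in>U. f w))" by simp
  moreover have "e U \<in> R" if "U \<subseteq> insert w T" for U
    using that c(2)[of U] d(2)[of "U - {w}"] by (auto simp: e_def)
  ultimately show ?thesis by (rule subset_expansionsI)
qed

section \<open>Indices of sums of subgroups\<close>

lemma a_rcosets_CC:
  "a_rcosets\<^bsub>CC\<lparr>carrier := A\<rparr>\<^esub> M = (\<lambda>a. (\<lambda>m. m + a) ` M) ` A"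
  by (auto simp: A_RCOSETS_def' a_r_coset_def')

lemma additive_subgroup_CC_if_subspace:
  assumes E: "Zmod.subspace E" and "E \<subseteq> A"
  shows "additive_subgroup E (CC\<lparr>carrier := A\<rparr>)"
proof (rule additive_subgroupI, rule subgroup.intro)
  show "E \<subseteq> carrier (add_monoid (CC\<lparr>carrier := A\<rparr>))" using assms by simp
next
  fix x y assume "x \<in> E" "y \<in> E"
  then show "x \<otimes>\<^bsub>add_monoid (CC\<lparr>carrier := A\<rparr>)\<^esub> y \<in> E"
    using Zmod.subspace_add[OF E] by simp
next
  show "\<one>\<^bsub>add_monoid (CC\<lparr>carrier := A\<rparr>)\<^esub> \<in> E"
    using Zmod.subspace_0[OF E] by simp
next
  fix x assume x: "x \<in> E"
  then have "- x \<in> E" using Zmod.subspace_neg[OF E] by simp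
  \<comment> \<open>\<open>A\<close> is only a set here, not known to be a group, so the inverse is
    found from its definition; \<open>- x\<close> lies in \<open>A\<close> because \<open>E\<close>
    does.\<close>
  moreover have "inv\<^bsub>add_monoid (CC\<lparr>carrier := A\<rparr>)\<^esub> x = - x"
    unfolding m_inv_def
  proof (rule the_equality)
    show "- x \<in> carrier (add_monoid (CC\<lparr>carrier := A\<rparr>)) \<and>
        x \<otimes>\<^bsub>add_monoid (CC\<lparr>carrier := A\<rparr>)\<^esub> - x = \<one>\<^bsub>add_monoid (CC\<lparr>carrier := A\<rparr>)\<^esub> \<and>
        - x \<otimes>\<^bsub>add_monoid (CC\<lparr>carrier := A\<rparr>)\<^esub> x = \<one>\<^bsub>add_monoid (CC\<lparr>carrier := A\<rparr>)\<^esub>"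
      using \<open>- x \<in> E\<close> assms(2) by auto
    fix y
    assume "y \<in> carrier (add_monoid (CC\<lparr>carrier := A\<rparr>)) \<and>
        x \<otimes>\<^bsub>add_monoid (CC\<lparr>carrier := A\<rparr>)\<^esub> y = \<one>\<^bsub>add_monoid (CC\<lparr>carrier := A\<rparr>)\<^esub> \<and>
        y \<otimes>\<^bsub>add_monoid (CC\<lparr>carrier := A\<rparr>)\<^esub> x = \<one>\<^bsub>add_monoid (CC\<lparr>carrier := A\<rparr>)\<^esub>"
    then have "x + y = 0" by simp
    then show "y = - x" by (rule minus_unique[symmetric])
  qed
  ultimately show "inv\<^bsub>add_monoid (CC\<lparr>carrier := A\<rparr>)\<^esub> x \<in> E" by simp
qed

lemma subspace_coset_eqI:
  assumes E: "Zmod.subspace E" and "a - b \<in> E"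
  shows "(\<lambda>m. m + a) ` E = (\<lambda>m. m + b) ` E"
proof (intro equalityI subsetI)
  fix x assume "x \<in> (\<lambda>m. m + a) ` E"
  then obtain m where m: "m \<in> E" "x = m + a" by blast
  then show "x \<in> (\<lambda>m. m + b) ` E"
    using Zmod.subspace_add[OF E m(1) assms(2)] by (intro image_eqI[of _ _ "m + (a - b)"]) auto
next
  fix x assume "x \<in> (\<lambda>m. m + b) ` E"
  then obtain m where m: "m \<in> E" "x = m + b" by blast
  then show "x \<in> (\<lambda>m. m + a) ` E"
    using Zmod.subspace_diff[OF E m(1) assms(2)] by (intro image_eqI[of _ _ "m - (a - b)"]) auto
qed

text \<open>Changing each coordinate \<open>a i\<close> by an element of \<open>M i\<close> changes
  the sum by an element of \<open>E\<close>. So tuples of cosets of the \<open>M i\<close> map onto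
  the cosets of \<open>E\<close> in \<open>R\<close>, and the number of tuples is the product of the
  indices.\<close>

lemma subgroup_index_sum_le_prod:
  fixes A M :: "'i \<Rightarrow> complex set" and k :: "'i \<Rightarrow> complex"
  assumes I: "finite I"
    and fin: "\<And>i. i \<in> I \<Longrightarrow> finite (a_rcosets\<^bsub>CC\<lparr>carrier := A i\<rparr>\<^esub> (M i))"
    and M: "\<And>i. i \<in> I \<Longrightarrow> Zmod.subspace (M i)"
    and E: "Zmod.subspace E" "E \<subseteq> R"
    and ME: "\<And>i m. i \<in> I \<Longrightarrow> m \<in> M i \<Longrightarrow> m * k i \<in> E"
    and R: "\<And>x. x \<in> R \<Longrightarrow> \<exists>a. (\<forall>i\<in>I. a i \<in> A i) \<and> x = (\<Sum>i\<in>I. a i * k i)"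
  shows "finite_index_subgroup E R"
    and "subgroup_index R E \<le> (\<Prod>i\<in>I. subgroup_index (A i) (M i))"
proof -
  define Cs where "Cs = PiE I (\<lambda>i. (\<lambda>a. (\<lambda>m. m + a) ` M i) ` A i)"
  \<comment> \<open>\<open>F\<close> sends a tuple of cosets to the coset of \<open>E\<close> given
    by arbitrarily chosen representatives.\<close>
  define F where "F C = (\<lambda>m. m + (\<Sum>i\<in>I. (SOME a. a \<in> C i) * k i)) ` E" for C
  have finCs: "finite Cs" unfolding Cs_def using fin by (intro finite_PiE I) (simp add: a_rcosets_CC)
  have cardCs: "card Cs = (\<Prod>i\<in>I. subgroup_index (A i) (M i))"
    unfolding Cs_def subgroup_index_def a_rcosets_CC by (rule card_PiE[OF I])
  have sub: "a_rcosets\<^bsub>CC\<lparr>carrier := R\<rparr>\<^esub> E \<subseteq> F ` Cs"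
    unfolding a_rcosets_CC[of R]
  proof (rule image_subsetI)
    fix x assume "x \<in> R"
    then obtain a where a: "\<And>i. i \<in> I \<Longrightarrow> a i \<in> A i" "x = (\<Sum>i\<in>I. a i * k i)"
      using R by blast
    define C where "C = (\<lambda>i\<in>I. (\<lambda>m. m + a i) ` M i)"
    have C: "C \<in> Cs" unfolding Cs_def C_def using a(1) by auto
    \<comment> \<open>The chosen representative may differ from \<open>a i\<close>, but only by an
      element of \<open>M i\<close>. The coset is nonempty since \<open>M i\<close> contains 0, so
      the choice is meaningful.\<close>
    have diff: "(SOME b. b \<in> C i) - a i \<in> M i" if "i \<in> I" for i
    proof -
      have "0 + a i \<in> C i"
        using that Zmod.subspace_0[OF M[OF that]] by (simp add: C_def)
      then have "(SOME b. b \<in> C i) \<in> C i" by (rule someI)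
      then show ?thesis using that by (auto simp: C_def)
    qed
    have "(\<Sum>i\<in>I. (SOME b. b \<in> C i) * k i) - x = (\<Sum>i\<in>I. ((SOME b. b \<in> C i) - a i) * k i)"
      by (simp add: a(2) left_diff_distrib sum_subtractf)
    also have "\<dots> \<in> E"
      using diff by (intro Zmod.subspace_sum[OF E(1)] ME)
    finally have "F C = (\<lambda>m. m + x) ` E"
      unfolding F_def by (rule subspace_coset_eqI[OF E(1)])
    then show "(\<lambda>m. m + x) ` E \<in> F ` Cs" using C by blast
  qed
  then have "finite (a_rcosets\<^bsub>CC\<lparr>carrier := R\<rparr>\<^esub> E)"
    using finCs finite_surj by blast
  then show "finite_index_subgroup E R"
    unfolding finite_index_subgroup_def using additive_subgroup_CC_if_subspace[OF E] by blast
  show "subgroup_index R E \<le> (\<Prod>i\<in>I. subgroup_index (A i) (M i))"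
    unfolding cardCs[symmetric] unfolding subgroup_index_def by (rule surj_card_le[OF finCs sub])
qed

section \<open>Multiquadratic extensions\<close>

lemma ring_of_integers_mono: "K \<subseteq> K' \<Longrightarrow> ring_of_integers K \<subseteq> ring_of_integers K'"
  by (auto simp: ring_of_integers_def)

lemma generate_field_CC_of_subfield:
  assumes "subfield K CC"
  shows "generate_field CC K = K"
  using generate_field_CC_minimal[OF assms subset_refl] by (auto intro: generate_field.incl)

text \<open>Each stage of the tower is a quadratic step over the field already reached. With
  \<open>K\<close> the rationals this bounds the degree of L.\<close>

lemma multiquadratic_field_expansion:
  assumes K: "subfield K CC" and "finite T" and "\<And>w. w \<in> T \<Longrightarrow> (f w)\<^sup>2 \<in> K"
    and "x \<in> generate_field CC (K \<union> f ` T)"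
  shows "x \<in> subset_expansions K f T"
  using assms(2-)
proof (induction T arbitrary: x)
  case empty
  then show ?case by (simp add: generate_field_CC_of_subfield[OF K] subset_expansions_empty)
next
  case (insert w T)
  let ?K = "generate_field CC (K \<union> f ` T)"
  have "(f w)\<^sup>2 \<in> ?K"
    using insert.prems(1)[of w] by (simp add: generate_field.incl)
  from generate_field_insert_sqrt[OF subfield_generate_field_CC this]
    generate_field_Un_image_insert[of K f w T] insert.prems(2)
  obtain u v where uv: "x = u + v * f w" "u \<in> ?K" "v \<in> ?K" by blast
  have "u \<in> subset_expansions K f T" "v \<in> subset_expansions K f T"
    using insert.IH[OF _ uv(2)] insert.IH[OF _ uv(3)] insert.prems(1) by simp_all
  then show ?case
    unfolding uv(1) by (rule subset_expansions_insert[OF insert.hyps(1,2)])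
qed

text \<open>The same tower for integers: the congruence modulo 4 and the integrality of the inverse
  root persist at every intermediate field, so the quadratic case applies at each stage.\<close>

lemma ring_of_integers_multiquadratic:
  assumes K: "subfield K CC" and "finite T"
    and "\<And>w. w \<in> T \<Longrightarrow> \<exists>a\<in>ring_of_integers K. (f w)\<^sup>2 = 1 + 4 * a"
    and "\<And>w. w \<in> T \<Longrightarrow> algebraic_int (inverse (f w))"
    and "x \<in> ring_of_integers (generate_field CC (K \<union> f ` T))"
  shows "x \<in> subset_expansions (ring_of_integers K) (\<lambda>w. (1 + f w) / 2) T"
  using assms(2-)
proof (induction T arbitrary: x)
  case empty
  then show ?case by (simp add: generate_field_CC_of_subfield[OF K] subset_expansions_empty)
next
  case (insert w T)
  let ?K = "generate_field CC (K \<union> f ` T)"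
  obtain a where a: "a \<in> ring_of_integers K" "(f w)\<^sup>2 = 1 + 4 * a"
    using insert.prems(1)[of w] by auto
  have "K \<subseteq> ?K" by (auto intro: generate_field.incl)
  then have aK: "a \<in> ring_of_integers ?K" using a(1) ring_of_integers_mono by blast
  have unit: "algebraic_int (inverse (f w))" by (rule insert.prems(2)) simp
  have "x \<in> ring_of_integers (generate_field CC (insert (f w) ?K))"
    using insert.prems(3) ring_of_integers_mono[OF generate_field_Un_image_insert[of K f w T]] by blast
  from ring_of_integers_quadratic[OF subfield_generate_field_CC aK a(2) unit this]
  obtain y z where yz: "x = y + z * ((1 + f w) / 2)" "y \<in> ring_of_integers ?K" "z \<in> ring_of_integers ?K"
    by blast
  have "y \<in> subset_expansions (ring_of_integers K) (\<lambda>w. (1 + f w) / 2) T"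
    "z \<in> subset_expansions (ring_of_integers K) (\<lambda>w. (1 + f w) / 2) T"
    using insert.IH[OF _ _ yz(2)] insert.IH[OF _ _ yz(3)] insert.prems(1,2) by simp_all
  then show ?case
    unfolding yz(1) by (rule subset_expansions_insert[OF insert.hyps(1,2)])
qed

section \<open>The degree of L over the rationals\<close>

lemma subfield_Rats_CC: "subfield \<rat> CC"
  unfolding subfield_CC_iff by simp

lemma degree_field_L_le:
  assumes "finite P"
  shows "degree_over_Q (field_L P) \<le> 2 ^ card P"
proof -
  let ?f = "\<lambda>p. complex_of_real (sqrt (real p))"
  let ?B = "(\<lambda>U. \<Prod>p\<in>U. ?f p) ` Pow P"
  have "field_L P \<subseteq> Qvec.span ?B"
  proof
    fix x assume "x \<in> field_L P"
    \<comment> \<open>Adding the rationals to the generators brings the field into the form of the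
      expansion lemma.\<close>
    moreover have "field_L P \<subseteq> generate_field CC (\<rat> \<union> ?f ` P)"
      unfolding field_L_def
      by (rule generate_field_CC_minimal[OF subfield_generate_field_CC]) (auto intro: generate_field.incl)
    ultimately have x: "x \<in> generate_field CC (\<rat> \<union> ?f ` P)" by blast
    have "(?f p)\<^sup>2 \<in> \<rat>" for p
      by (simp flip: of_real_power)
    from multiquadratic_field_expansion[OF subfield_Rats_CC assms this x]
    obtain c where c: "x = (\<Sum>U\<in>Pow P. c U * (\<Prod>p\<in>U. ?f p))" "\<And>U. U \<subseteq> P \<Longrightarrow> c U \<in> \<rat>"
      by (rule subset_expansionsE) (erule that, blast)
    show "x \<in> Qvec.span ?B"
      unfolding c(1)
    proof (rule Qvec.span_sum)
      fix U assume U: "U \<in> Pow P"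
      then obtain q where q: "c U = of_rat q" using c(2) by (meson PowD Rats_cases)
      show "c U * (\<Prod>p\<in>U. ?f p) \<in> Qvec.span ?B"
        unfolding q using U by (intro Qvec.span_scale Qvec.span_base imageI)
    qed
  qed
  then have "degree_over_Q (field_L P) \<le> card ?B"
    unfolding degree_over_Q_def using assms by (intro Qvec.dim_le_card) simp_all
  also have "\<dots> \<le> card (Pow P)" using assms by (intro card_image_le) simp
  also have "\<dots> = 2 ^ card P" using assms by (rule card_Pow)
  finally show ?thesis .
qed

section \<open>The index of \<open>O_eps\<close> in the ring of integers of \<open>N\<close>\<close>

lemma integer_unitsD:
  assumes "w \<in> integer_units K"
  shows "w \<noteq> 0" "algebraic_int (inverse w)"
proof -
  obtain v where v: "v \<in> ring_of_integers K" "v * w = 1"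
    using assms by (auto simp: integer_units_def Units_def)
  then show "w \<noteq> 0" by auto
  have "inverse w = v" using v(2) inverse_unique[of w v] by (simp add: mult.commute)
  then show "algebraic_int (inverse w)" using v by (simp add: ring_of_integers_def)
qed

lemma ring_of_integers_prod:
  assumes "subfield K CC" "\<And>i. i \<in> I \<Longrightarrow> f i \<in> ring_of_integers K"
  shows "(\<Prod>i\<in>I. f i) \<in> ring_of_integers K"
  using assms(2) ring_of_integers_closed(4)[OF assms(1), of 1]
  by (induction I rule: infinite_finite_induct) (simp_all add: ring_of_integers_closed[OF assms(1)])

lemma subspace_ring_of_integers:
  assumes "subfield K CC"
  shows "Zmod.subspace (ring_of_integers K)"
  by (rule Zmod.subspaceI) (simp_all add: ring_of_integers_closed[OF assms])

text \<open>The index lemma is applied with one summand per subset \<open>T\<close>. The multiplier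
  \<open>?k T\<close> cancels \<open>q_elt r T\<close> and inserts \<open>eta_elt r T\<close>, so it
  carries \<open>?A T\<close> to the summand of the ring of integers belonging to \<open>T\<close>,
  and the span of \<open>B T\<close> into \<open>O_eps S r B\<close>.\<close>

lemma O_eps_index_le_prod:
  assumes data: "field_data P S r N"
    and fin: "\<And>T. T \<subseteq> S \<Longrightarrow> finite_index_subgroup (Zmod.span (B T))
      ((\<lambda>x. x * q_elt r T) ` ring_of_integers (field_L P))"
  shows "finite_index_subgroup (O_eps S r B) (ring_of_integers N)"
    and "subgroup_index (ring_of_integers N) (O_eps S r B) \<le>
      (\<Prod>T\<in>Pow S. subgroup_index ((\<lambda>x. x * q_elt r T) ` ring_of_integers (field_L P)) (Zmod.span (B T)))"
proof -
  let ?L = "field_L P"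
  let ?A = "\<lambda>T. (\<lambda>x. x * q_elt r T) ` ring_of_integers ?L"
  let ?k = "\<lambda>T. inverse (q_elt r T) * eta_elt r T"
  have S: "finite S" and N: "N = generate_field CC (?L \<union> r ` S)"
    using data by (auto simp: field_data_def)
  have sqrt: "(r w)\<^sup>2 = w" "w \<in> integer_units ?L" "\<exists>a\<in>ring_of_integers ?L. w = 1 + 4 * a" if "w \<in> S" for w
    using data that by (auto simp: field_data_def)
  have L: "subfield ?L CC" unfolding field_L_def by (rule subfield_generate_field_CC)
  have NK: "subfield N CC" unfolding N by (rule subfield_generate_field_CC)
  have LN: "ring_of_integers ?L \<subseteq> ring_of_integers N"
    unfolding N by (rule ring_of_integers_mono) (auto intro: generate_field.incl)
  have r0: "r w \<noteq> 0" if "w \<in> S" for w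
    using sqrt(1)[OF that] integer_unitsD(1)[OF sqrt(2)[OF that]] by auto
  then have q0: "q_elt r T \<noteq> 0" if "T \<subseteq> S" for T
    using that S finite_subset[of T S] by (auto simp: q_elt_def)
  have half: "(1 + r w) / 2 \<in> ring_of_integers N" if w: "w \<in> S" for w
  proof -
    obtain a where a: "a \<in> ring_of_integers ?L" "w = 1 + 4 * a" using sqrt(3)[OF w] by blast
    have "algebraic_int ((1 + r w) / 2)"
      using a sqrt(1)[OF w] by (intro algebraic_int_half_one_plus_sqrt[of a]) (auto simp: ring_of_integers_def)
    moreover have "r w \<in> N" unfolding N using w by (auto intro: generate_field.incl)
    ultimately show ?thesis by (simp add: ring_of_integers_def subfield_CC_closed[OF NK])
  qed
  then have eta: "eta_elt r T \<in> ring_of_integers N" if "T \<subseteq> S" for T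
    unfolding eta_elt_def using that by (intro ring_of_integers_prod[OF NK]) auto
  have sub: "Zmod.subspace (O_eps S r B)"
    unfolding O_eps_def by (rule Zmod.subspace_span)
  have incl: "O_eps S r B \<subseteq> ring_of_integers N"
    unfolding O_eps_def
  proof (rule Zmod.span_minimal[OF _ subspace_ring_of_integers[OF NK]], rule subsetI)
    fix y assume "y \<in> {b * inverse (q_elt r T) * eta_elt r T |T b. T \<subseteq> S \<and> b \<in> B T}"
    then obtain T b where y: "y = b * inverse (q_elt r T) * eta_elt r T" "T \<subseteq> S" "b \<in> B T" by blast
    \<comment> \<open>Being a subgroup of \<open>?A T\<close>, the span contains only multiples of
      \<open>q_elt r T\<close> by integers of L, so the division in the generator leaves such an
      integer.\<close>
    have "Zmod.span (B T) \<subseteq> ?A T"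
      using fin[OF y(2)] additive_subgroup.a_subset by (force simp: finite_index_subgroup_def)
    then obtain x where x: "x \<in> ring_of_integers ?L" "b = x * q_elt r T"
      using Zmod.span_base[OF y(3)] by blast
    then have "y = x * eta_elt r T" using y q0[OF y(2)] by simp
    then show "y \<in> ring_of_integers N"
      using x(1) LN eta[OF y(2)] ring_of_integers_closed(3)[OF NK] by blast
  qed
  have ME: "m * ?k T \<in> O_eps S r B" if T: "T \<in> Pow S" and m: "m \<in> Zmod.span (B T)" for T m
    using m
  proof (induction rule: Zmod.span_induct_alt)
    case base
    show ?case using Zmod.subspace_0[OF sub] by simp
  next
    case (step c b y)
    have "b * ?k T \<in> O_eps S r B"
      unfolding O_eps_def using T step.hyps
      by (intro Zmod.span_base CollectI exI[of _ T] exI[of _ b]) (simp add: mult.assoc)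
    then have "of_int c * (b * ?k T) + y * ?k T \<in> O_eps S r B"
      using step.IH by (intro Zmod.subspace_add[OF sub] Zmod.subspace_scale[OF sub])
    then show ?case by (simp only: distrib_right mult.assoc)
  qed
  have gen: "\<exists>a. (\<forall>T\<in>Pow S. a T \<in> ?A T) \<and> x = (\<Sum>T\<in>Pow S. a T * ?k T)"
    if x: "x \<in> ring_of_integers N" for x
  proof -
    \<comment> \<open>The square of this inverse is the inverse of the unit \<open>w\<close>, hence
      integral.\<close>
    have "algebraic_int (inverse (r w))" if "w \<in> S" for w
    proof (rule algebraic_int_of_power2)
      show "algebraic_int ((inverse (r w))\<^sup>2)"
        using integer_unitsD(2)[OF sqrt(2)[OF that]] sqrt(1)[OF that] by (simp add: power_inverse)
    qed
    with x have "x \<in> subset_expansions (ring_of_integers ?L) (\<lambda>w. (1 + r w) / 2) S"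
      using sqrt by (intro ring_of_integers_multiquadratic[OF L S]) (simp_all add: N)
    then obtain c where c: "x = (\<Sum>T\<in>Pow S. c T * (\<Prod>w\<in>T. (1 + r w) / 2))"
      "\<And>T. T \<subseteq> S \<Longrightarrow> c T \<in> ring_of_integers ?L"
      by (rule subset_expansionsE) (erule that, blast)
    show ?thesis
    proof (intro exI conjI ballI)
      \<comment> \<open>The coefficient of \<open>eta_elt r T\<close> is multiplied by
        \<open>q_elt r T\<close> to land in \<open>?A T\<close>; \<open>?k T\<close> undoes
        this.\<close>
      show "c T * q_elt r T \<in> ?A T" if "T \<in> Pow S" for T using c(2) that by blast
      show "x = (\<Sum>T\<in>Pow S. c T * q_elt r T * ?k T)"
        unfolding c(1) eta_elt_def[symmetric] using q0 by (intro sum.cong) simp_all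
    qed
  qed
  have finP: "finite (Pow S)" using S by simp
  have fin': "finite (a_rcosets\<^bsub>CC\<lparr>carrier := ?A T\<rparr>\<^esub> (Zmod.span (B T)))" if "T \<in> Pow S" for T
    using fin that by (simp add: finite_index_subgroup_def)
  note index = subgroup_index_sum_le_prod[where I = "Pow S" and M = "\<lambda>T. Zmod.span (B T)"
    and A = ?A and k = ?k, OF finP fin' Zmod.subspace_span sub incl ME gen]
  show "finite_index_subgroup (O_eps S r B) (ring_of_integers N)" by (rule index(1))
  show "subgroup_index (ring_of_integers N) (O_eps S r B) \<le>
      (\<Prod>T\<in>Pow S. subgroup_index (?A T) (Zmod.span (B T)))" by (rule index(2))
qed

theorem theorem3p8:
  fixes c\<^sub>0 :: real
    and \<N> :: "complex set set"
    and P :: "complex set \<Rightarrow> nat set"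
    and S :: "complex set \<Rightarrow> complex set"
    and r :: "complex set \<Rightarrow> complex \<Rightarrow> complex"
  assumes "field_family c\<^sub>0 \<N> P S r"
  shows "\<forall>\<epsilon>>0. \<exists>n\<^sub>0::nat. \<forall>N\<in>\<N>. degree_over_Q N \<ge> n\<^sub>0 \<longrightarrow>
           (\<forall>B. admissible_bases (P N) (S N) (r N) N \<epsilon> B \<longrightarrow>
              finite_index_subgroup (O_eps (S N) (r N) B) (ring_of_integers N) \<and>
              real (subgroup_index (ring_of_integers N) (O_eps (S N) (r N) B))
                \<le> real (degree_over_Q N) powr (3 * real (degree_over_Q N) * \<epsilon> / 2))"
\<comment> \<open>The threshold is 0: the estimate is derived for each \<open>N\<close> separately
  from the index bounds in \<open>admissible_bases\<close>.\<close>
proof (intro allI impI exI[of _ 0] ballI)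
  fix \<epsilon> :: real and N B
  assume "\<epsilon> > 0" "N \<in> \<N>" and adm: "admissible_bases (P N) (S N) (r N) N \<epsilon> B"
  let ?P = "P N" and ?S = "S N" and ?r = "r N"
  let ?L = "field_L ?P" and ?n = "real (degree_over_Q N)"
  let ?A = "\<lambda>T. (\<lambda>x. x * q_elt ?r T) ` ring_of_integers ?L"
  have data: "field_data ?P ?S ?r N"
    using assms \<open>N \<in> \<N>\<close> by (simp add: field_family_def)
  then have S: "finite ?S" and P: "finite ?P" and n: "degree_over_Q N = 2 ^ (card ?S + card ?P)"
    by (simp_all add: field_data_def)
  have fin: "finite_index_subgroup (Zmod.span (B T)) (?A T)"
    and le: "real (subgroup_index (?A T) (Zmod.span (B T))) \<le> ?n powr (3 * \<epsilon> * real (degree_over_Q ?L) / 2)"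
    if "T \<subseteq> ?S" for T
    using adm that by (simp_all add: admissible_bases_def Let_def)
  have n1: "?n \<ge> 1" by (simp add: n)
  have "real (degree_over_Q ?L) * 2 ^ card ?S \<le> 2 ^ card ?P * 2 ^ card ?S"
    using degree_field_L_le[OF P] by (intro mult_right_mono) (simp_all flip: of_nat_le_iff)
  then have deg: "2 ^ card ?S * real (degree_over_Q ?L) \<le> ?n"
    by (simp add: n power_add mult.commute)
  have "real (subgroup_index (ring_of_integers N) (O_eps ?S ?r B))
      \<le> real (\<Prod>T\<in>Pow ?S. subgroup_index (?A T) (Zmod.span (B T)))"
    by (rule of_nat_mono[OF O_eps_index_le_prod(2)[OF data fin]])
  also have "\<dots> \<le> (\<Prod>T\<in>Pow ?S. ?n powr (3 * \<epsilon> * real (degree_over_Q ?L) / 2))"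
    unfolding of_nat_prod using le by (intro prod_mono) simp
  \<comment> \<open>The equal factors, one for each subset of \<open>?S\<close>, combine into a
    single power. Its exponent can then be enlarged because the base is at least 1.\<close>
  also have "\<dots> = ?n powr (2 ^ card ?S * real (degree_over_Q ?L) * (3 * \<epsilon> / 2))"
    using S n1 by (simp add: card_Pow powr_powr ac_simps flip: powr_realpow)
  also have "\<dots> \<le> ?n powr (3 * ?n * \<epsilon> / 2)"
    using deg n1 \<open>\<epsilon> > 0\<close> mult_right_mono[OF deg, of "3 * \<epsilon> / 2"]
    by (intro powr_mono) (simp_all add: ac_simps)
  finally show "finite_index_subgroup (O_eps ?S ?r B) (ring_of_integers N) \<and>
      real (subgroup_index (ring_of_integers N) (O_eps ?S ?r B)) \<le> ?n powr (3 * ?n * \<epsilon> / 2)"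
    using O_eps_index_le_prod(1)[OF data fin] by blast
qed

end
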